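(* Let $A$ and $B$ be associative unital algebras over $\mathbb{C}$, with products $\mu_A: A\otimes A\to A$, $\mu_B: B\otimes B\to B$ and units $1_A$, $1_B$. Let $\sigma: A\otimes B\to B\otimes A$ be a linear map such that $$\sigma\circ(\mu_A\otimes \mathrm{id}_B)=(\mathrm{id}_B\otimes\mu_A)\circ\sigma_{12}\circ\sigma_{23}\quad\text{on } A\otimes A\otimes B,$$ $$\sigma\circ(\mathrm{id}_A\otimes \mu_B)=(\mu_B\otimes\mathrm{id}_A)\circ\sigma_{23}\circ\sigma_{12}\quad\text{on } A\otimes B\otimes B,$$ $$\sigma(1_A\otimes b)=b\otimes 1_A,\qquad \sigma(a\otimes 1_B)=1_B\otimes a\qquad\text{for all } a\in A,\ b\in B.$$ Define the bilinear map $*$ on $B\otimes A$ by $$(b\otimes a)*(b'\otimes a'):=(\mu_B\otimes\mu_A)\circ(\mathrm{id}_B\otimes\sigma\otimes\mathrm{id}_A)(b\otimes a\otimes b'\otimes a').$$ Then the map $*$ endows the space $B\otimes A$ with the structure of a unital associative algebra with unit element $1_B\otimes 1_A$.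
   Context: All tensor products are over $\mathbb{C}$. The notation $\sigma_{12}$ (respectively $\sigma_{23}$) means that $\sigma$ is applied to the tensor factors in positions 1, 2 (respectively 2, 3) of a triple tensor product, with the identity on the remaining factor. Thus on $A\otimes A\otimes B$ one has $\sigma_{23}=\mathrm{id}_A\otimes\sigma: A\otimes A\otimes B\to A\otimes B\otimes A$, followed by $\sigma_{12}=\sigma\otimes\mathrm{id}_A: A\otimes B\otimes A\to B\otimes A\otimes A$. On $A\otimes B\otimes B$ one has $\sigma_{12}=\sigma\otimes\mathrm{id}_B: A\otimes B\otimes B\to B\otimes A\otimes B$, followed by $\sigma_{23}=\mathrm{id}_B\otimes\sigma: B\otimes A\otimes B\to B\otimes B\otimes A$. *)

theory Defs
  imports Complex_Main "HOL-Library.Poly_Mapping"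
begin

class scaleC =
  fixes scaleC :: "complex \<Rightarrow> 'a \<Rightarrow> 'a"  (infixr \<open>*\<^sub>C\<close> 75)

class complex_vector = ab_group_add + scaleC +
  assumes scaleC_add_right: "c *\<^sub>C (x + y) = c *\<^sub>C x + c *\<^sub>C y"
    and scaleC_add_left: "(c + d) *\<^sub>C x = c *\<^sub>C x + d *\<^sub>C x"
    and scaleC_scaleC: "c *\<^sub>C (d *\<^sub>C x) = (c * d) *\<^sub>C x"
    and scaleC_one: "1 *\<^sub>C x = x"

global_interpretation complex_vector:
  vector_space "scaleC :: complex \<Rightarrow> 'a \<Rightarrow> 'a::complex_vector"
  by unfold_locales
    (rule scaleC_add_right scaleC_add_left scaleC_scaleC scaleC_one)+

abbreviation clinear :: "('a::complex_vector \<Rightarrow> 'b::complex_vector) \<Rightarrow> bool"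
  where "clinear \<equiv> Vector_Spaces.linear scaleC scaleC"

definition cbilinear :: "('a::complex_vector \<Rightarrow> 'b::complex_vector \<Rightarrow> 'c::complex_vector) \<Rightarrow> bool"
  where "cbilinear h \<longleftrightarrow> (\<forall>x. clinear (\<lambda>y. h x y)) \<and> (\<forall>y. clinear (\<lambda>x. h x y))"

lemma clinear_iff:
  "clinear f \<longleftrightarrow> (\<forall>x y. f (x + y) = f x + f y) \<and> (\<forall>c x. f (c *\<^sub>C x) = c *\<^sub>C f x)"
  by (auto simp: Vector_Spaces.linear_def module_hom_def module_hom_axioms_def
      complex_vector.vector_space_axioms complex_vector.module_axioms)

lemma clinear_id: "clinear (\<lambda>x. x)" "clinear id"
  by (simp_all add: clinear_iff)

lemma clinear_compose: "clinear f \<Longrightarrow> clinear g \<Longrightarrow> clinear (g \<circ> f)"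
  by (simp add: clinear_iff)

lemma clinear_zero: "clinear f \<Longrightarrow> f 0 = 0"
  unfolding clinear_iff by (metis add_cancel_right_right)

lemma clinear_diff: "clinear f \<Longrightarrow> f (x - y) = f x - f y"
  unfolding clinear_iff by (metis add_diff_cancel diff_add_cancel)

lemma cbilinear_iff:
  "cbilinear h \<longleftrightarrow>
    (\<forall>x x' y. h (x + x') y = h x y + h x' y) \<and> (\<forall>x y y'. h x (y + y') = h x y + h x y') \<and>
    (\<forall>c x y. h (c *\<^sub>C x) y = c *\<^sub>C h x y) \<and> (\<forall>c x y. h x (c *\<^sub>C y) = c *\<^sub>C h x y)"
  by (auto simp: cbilinear_def clinear_iff)

instantiation poly_mapping :: (type, complex_vector) complex_vector
begin

lift_definition scaleC_poly_mapping :: "complex \<Rightarrow> ('a \<Rightarrow>\<^sub>0 'b) \<Rightarrow> 'a \<Rightarrow>\<^sub>0 'b"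
  is "\<lambda>c f k. c *\<^sub>C f k"
  by (erule rev_finite_subset) auto

instance
  by standard
    (transfer, simp add: scaleC_add_right scaleC_add_left scaleC_scaleC scaleC_one)+

end

instantiation complex :: complex_vector
begin

definition scaleC_complex :: "complex \<Rightarrow> complex \<Rightarrow> complex"
  where "scaleC_complex = (*)"

instance
  by standard (simp_all add: scaleC_complex_def algebra_simps)

end

lemma lookup_scaleC: "Poly_Mapping.lookup (c *\<^sub>C p) k = c *\<^sub>C Poly_Mapping.lookup p k"
  by transfer simp

text \<open>
  The tensor product is the free vector space on the set of pairs, divided by the subspace
  spanned by the bilinearity relations.
\<close>

definition tensor_relators :: "('a::complex_vector \<times> 'b::complex_vector \<Rightarrow>\<^sub>0 complex) set"
  where "tensor_relators =
    {Poly_Mapping.single (x + x', y) 1 - Poly_Mapping.single (x, y) 1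
       - Poly_Mapping.single (x', y) 1 | x x' y. True} \<union>
    {Poly_Mapping.single (x, y + y') 1 - Poly_Mapping.single (x, y) 1
       - Poly_Mapping.single (x, y') 1 | x y y'. True} \<union>
    {Poly_Mapping.single (c *\<^sub>C x, y) 1 - c *\<^sub>C Poly_Mapping.single (x, y) 1 | c x y. True} \<union>
    {Poly_Mapping.single (x, c *\<^sub>C y) 1 - c *\<^sub>C Poly_Mapping.single (x, y) 1 | c x y. True}"

definition tensor_rel ::
    "('a::complex_vector \<times> 'b::complex_vector \<Rightarrow>\<^sub>0 complex) \<Rightarrow> ('a \<times> 'b \<Rightarrow>\<^sub>0 complex) \<Rightarrow> bool"
  where "tensor_rel p q \<longleftrightarrow> p - q \<in> complex_vector.span tensor_relators"

lemma equivp_tensor_rel: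
  "equivp (tensor_rel :: ('a::complex_vector \<times> 'b::complex_vector \<Rightarrow>\<^sub>0 complex) \<Rightarrow> _)"
  (is "equivp ?R")
proof (rule equivpI)
  show "reflp ?R"
    by (simp add: reflp_def tensor_rel_def complex_vector.span_zero)
  show "symp ?R"
    unfolding symp_def tensor_rel_def by (metis complex_vector.span_neg minus_diff_eq)
  show "transp ?R"
    unfolding transp_def tensor_rel_def
  proof (intro allI impI)
    fix p q r :: "'a \<times> 'b \<Rightarrow>\<^sub>0 complex"
    assume "p - q \<in> complex_vector.span tensor_relators" "q - r \<in> complex_vector.span tensor_relators"
    from complex_vector.span_add[OF this] show "p - r \<in> complex_vector.span tensor_relators"
      by simp
  qed
qed

quotient_type (overloaded) ('a, 'b) tensor_prod (infixr \<open>\<otimes>\<close> 70) =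
    "('a::complex_vector \<times> 'b::complex_vector) \<Rightarrow>\<^sub>0 complex" / tensor_rel
  by (rule equivp_tensor_rel)

instantiation tensor_prod :: (complex_vector, complex_vector) complex_vector
begin

lift_definition zero_tensor_prod :: "'a \<otimes> 'b" is 0 .

lift_definition plus_tensor_prod :: "'a \<otimes> 'b \<Rightarrow> 'a \<otimes> 'b \<Rightarrow> 'a \<otimes> 'b" is "(+)"
  unfolding tensor_rel_def by (simp add: add_diff_add complex_vector.span_add)

lift_definition uminus_tensor_prod :: "'a \<otimes> 'b \<Rightarrow> 'a \<otimes> 'b" is uminus
  unfolding tensor_rel_def by (simp only: minus_diff_minus complex_vector.span_neg)

lift_definition minus_tensor_prod :: "'a \<otimes> 'b \<Rightarrow> 'a \<otimes> 'b \<Rightarrow> 'a \<otimes> 'b" is "(-)"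
  unfolding tensor_rel_def by (drule (1) complex_vector.span_diff) (simp add: algebra_simps)

lift_definition scaleC_tensor_prod :: "complex \<Rightarrow> 'a \<otimes> 'b \<Rightarrow> 'a \<otimes> 'b" is "(*\<^sub>C)"
  unfolding tensor_rel_def
  by (simp add: complex_vector.span_scale flip: complex_vector.scale_right_diff_distrib)

instance
  by standard
    (transfer, simp add: tensor_rel_def complex_vector.span_zero algebra_simps
      scaleC_add_right scaleC_add_left scaleC_scaleC scaleC_one)+

end

lift_definition tensor :: "'a::complex_vector \<Rightarrow> 'b::complex_vector \<Rightarrow> 'a \<otimes> 'b" (infixr \<open>\<otimes>\<close> 70)
  is "\<lambda>x y. Poly_Mapping.single (x, y) 1" .

lemma cbilinear_tensor: "cbilinear (\<otimes>)"
  unfolding cbilinear_iff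
proof (intro conjI allI)
  fix x x' :: 'a and y y' :: 'b and c
  show "(x + x') \<otimes> y = x \<otimes> y + x' \<otimes> y"
    by transfer (unfold tensor_rel_def diff_diff_eq[symmetric],
      rule complex_vector.span_base, unfold tensor_relators_def, blast)
  show "x \<otimes> (y + y') = x \<otimes> y + x \<otimes> y'"
    by transfer (unfold tensor_rel_def diff_diff_eq[symmetric],
      rule complex_vector.span_base, unfold tensor_relators_def, blast)
  show "(c *\<^sub>C x) \<otimes> y = c *\<^sub>C (x \<otimes> y)"
    by transfer (unfold tensor_rel_def,
      rule complex_vector.span_base, unfold tensor_relators_def, blast)
  show "x \<otimes> (c *\<^sub>C y) = c *\<^sub>C (x \<otimes> y)"
    by transfer (unfold tensor_rel_def,
      rule complex_vector.span_base, unfold tensor_relators_def, blast)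
qed

lemma tensor_simps:
  "(x + x') \<otimes> y = x \<otimes> y + x' \<otimes> y"
  "x \<otimes> (y + y') = x \<otimes> y + x \<otimes> y'"
  "(c *\<^sub>C x) \<otimes> y = c *\<^sub>C (x \<otimes> y)"
  "x \<otimes> (c *\<^sub>C y) = c *\<^sub>C (x \<otimes> y)"
  by (simp_all add: cbilinear_tensor[unfolded cbilinear_iff])

lemma abs_tensor_prod_cases:
  obtains p where "t = abs_tensor_prod p"
  by (induction t rule: tensor_prod.abs_induct) blast

lemma clinear_abs_tensor_prod: "clinear abs_tensor_prod"
  by (simp add: clinear_iff plus_tensor_prod.abs_eq scaleC_tensor_prod.abs_eq)

lemma poly_mapping_eq_sum_single:
  "p = (\<Sum>k\<in>Poly_Mapping.keys p. Poly_Mapping.lookup p k *\<^sub>C Poly_Mapping.single k (1::complex))"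
proof (rule poly_mapping_eqI)
  fix k
  have "Poly_Mapping.lookup (\<Sum>k\<in>Poly_Mapping.keys p. Poly_Mapping.lookup p k *\<^sub>C Poly_Mapping.single k (1::complex)) k
      = (\<Sum>j\<in>Poly_Mapping.keys p. if j = k then Poly_Mapping.lookup p k else 0)"
    unfolding lookup_sum
    by (rule sum.cong) (auto simp: lookup_scaleC lookup_single scaleC_complex_def when_def)
  then show "Poly_Mapping.lookup p k = Poly_Mapping.lookup (\<Sum>k\<in>Poly_Mapping.keys p. Poly_Mapping.lookup p k *\<^sub>C Poly_Mapping.single k 1) k"
    by (simp add: in_keys_iff)
qed

lemma tensor_induct [case_names zero tensor add]:
  fixes P :: "'a::complex_vector \<otimes> 'b::complex_vector \<Rightarrow> bool"
  assumes zero: "P 0" and tensor: "\<And>x y. P (x \<otimes> y)"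
    and add: "\<And>s t. P s \<Longrightarrow> P t \<Longrightarrow> P (s + t)"
  shows "P t"
proof (cases t rule: abs_tensor_prod_cases)
  case (1 p)
  have summand: "P (abs_tensor_prod (c *\<^sub>C Poly_Mapping.single k 1))" for c k
  proof -
    have "abs_tensor_prod (c *\<^sub>C Poly_Mapping.single k 1) = (c *\<^sub>C fst k) \<otimes> snd k"
      unfolding tensor_simps by (simp add: tensor.abs_eq scaleC_tensor_prod.abs_eq)
    then show ?thesis
      by (simp only: tensor)
  qed
  have "P (abs_tensor_prod (\<Sum>k\<in>K. f k *\<^sub>C Poly_Mapping.single k 1))" for K f
    by (induction K rule: infinite_finite_induct)
      (auto simp flip: zero_tensor_prod.abs_eq plus_tensor_prod.abs_eq
        intro: summand zero add)
  then show ?thesis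
    using poly_mapping_eq_sum_single[of p] 1 by metis
qed

lemma clinear_tensor_eqI:
  assumes "clinear f" "clinear g" "\<And>x y. f (x \<otimes> y) = g (x \<otimes> y)"
  shows "f = g"
proof
  fix t show "f t = g t"
    using assms by (induction t rule: tensor_induct) (auto simp: clinear_zero, simp add: clinear_iff)
qed

definition tensor_lift ::
    "('a::complex_vector \<Rightarrow> 'b::complex_vector \<Rightarrow> 'c::complex_vector) \<Rightarrow> 'a \<otimes> 'b \<Rightarrow> 'c"
  where "tensor_lift h = (THE f. clinear f \<and> (\<forall>x y. f (x \<otimes> y) = h x y))"

theorem tensor_universal:
  assumes h: "cbilinear h"
  shows "\<exists>!f. clinear f \<and> (\<forall>x y. f (x \<otimes> y) = h x y)"
proof -
  define F where "F p = (\<Sum>k\<in>Poly_Mapping.keys p. Poly_Mapping.lookup p k *\<^sub>C h (fst k) (snd k))" for p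
  have F: "F p = (\<Sum>k\<in>K. Poly_Mapping.lookup p k *\<^sub>C h (fst k) (snd k))" if "finite K" "Poly_Mapping.keys p \<subseteq> K" for p K
    unfolding F_def using that by (intro sum.mono_neutral_left) (auto simp: in_keys_iff)
  have F_add: "F (p + q) = F p + F q" for p q
  proof -
    let ?K = "Poly_Mapping.keys p \<union> Poly_Mapping.keys q"
    have "Poly_Mapping.keys (p + q) \<subseteq> ?K" by (rule keys_add)
    then show ?thesis
      by (simp add: F[of ?K] lookup_add scaleC_add_left sum.distrib)
  qed
  have F_scale: "F (c *\<^sub>C p) = c *\<^sub>C F p" for c p
  proof -
    have "Poly_Mapping.keys (c *\<^sub>C p) \<subseteq> Poly_Mapping.keys p"
      by (auto simp: in_keys_iff lookup_scaleC scaleC_complex_def)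
    then show ?thesis
      by (simp add: F[of "Poly_Mapping.keys p"] lookup_scaleC scaleC_complex_def scaleC_scaleC
          complex_vector.scale_sum_right)
  qed
  have F_lin: "clinear F"
    using F_add F_scale by (simp add: clinear_iff)
  have F_single: "F (Poly_Mapping.single (x, y) 1) = h x y" for x y
    by (simp add: F_def scaleC_one)
  have relators: "F r = 0" if "r \<in> tensor_relators" for r
    using that h
    by (auto simp: tensor_relators_def clinear_diff[OF F_lin] F_scale F_single cbilinear_iff)
  have "complex_vector.span tensor_relators \<subseteq> {p. F p = 0}"
    using relators
    by (intro complex_vector.span_minimal)
      (auto simp: complex_vector.subspace_def F_add F_scale clinear_zero[OF F_lin])
  then have resp: "F p = F q" if "tensor_rel p q" for p q
    using that clinear_diff[OF F_lin, of p q] by (auto simp: tensor_rel_def)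
  define f where "f t = F (rep_tensor_prod t)" for t
  have f_abs: "f (abs_tensor_prod p) = F p" for p
    unfolding f_def
    by (rule resp) (metis Quotient_tensor_prod Quotient_rep_abs equivp_reflp equivp_tensor_rel)
  have "f (s + t) = f s + f t" for s t
    by (cases s rule: abs_tensor_prod_cases; cases t rule: abs_tensor_prod_cases) (simp add: f_abs plus_tensor_prod.abs_eq F_add)
  moreover have "f (c *\<^sub>C t) = c *\<^sub>C f t" for c t
    by (cases t rule: abs_tensor_prod_cases) (simp add: f_abs scaleC_tensor_prod.abs_eq F_scale)
  ultimately have "clinear f"
    by (simp add: clinear_iff)
  moreover have "f (x \<otimes> y) = h x y" for x y
    by (simp add: tensor.abs_eq f_abs F_single)
  ultimately show ?thesis
    by (intro ex1I[of _ f]) (auto intro!: clinear_tensor_eqI)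
qed

lemma
  assumes "cbilinear h"
  shows clinear_tensor_lift: "clinear (tensor_lift h)"
    and tensor_lift_tensor: "tensor_lift h (x \<otimes> y) = h x y"
  using theI'[OF tensor_universal[OF assms]] by (simp_all add: tensor_lift_def)

definition tensor_map ::
    "('a::complex_vector \<Rightarrow> 'c::complex_vector) \<Rightarrow> ('b::complex_vector \<Rightarrow> 'd::complex_vector)
      \<Rightarrow> 'a \<otimes> 'b \<Rightarrow> 'c \<otimes> 'd"
  where "tensor_map f g = tensor_lift (\<lambda>x y. f x \<otimes> g y)"

lemma
  assumes "clinear f" "clinear g"
  shows clinear_tensor_map: "clinear (tensor_map f g)"
    and tensor_map_tensor: "tensor_map f g (x \<otimes> y) = f x \<otimes> g y"
proof -
  have "cbilinear (\<lambda>x y. f x \<otimes> g y)"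
    using assms by (simp add: cbilinear_iff clinear_iff tensor_simps)
  then show "clinear (tensor_map f g)" "tensor_map f g (x \<otimes> y) = f x \<otimes> g y"
    unfolding tensor_map_def by (rule clinear_tensor_lift, rule tensor_lift_tensor)
qed

text \<open>
  As \<open>\<otimes>\<close> associates to the right, triple tensor products are \<open>'a \<otimes> ('b \<otimes> 'c)\<close>.
  The associativity isomorphisms are kept explicit.
\<close>

definition tensor_assoc ::
    "('a::complex_vector \<otimes> 'b::complex_vector) \<otimes> 'c::complex_vector \<Rightarrow> 'a \<otimes> 'b \<otimes> 'c"
  where "tensor_assoc = tensor_lift (\<lambda>t z. tensor_lift (\<lambda>x y. x \<otimes> y \<otimes> z) t)"

definition tensor_unassoc ::
    "'a::complex_vector \<otimes> 'b::complex_vector \<otimes> 'c::complex_vector \<Rightarrow> ('a \<otimes> 'b) \<otimes> 'c"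
  where "tensor_unassoc = tensor_lift (\<lambda>x t. tensor_lift (\<lambda>y z. (x \<otimes> y) \<otimes> z) t)"

lemma
  fixes x :: "'a::complex_vector" and y :: "'b::complex_vector" and z :: "'c::complex_vector"
  shows clinear_tensor_assoc: "clinear (tensor_assoc :: ('a \<otimes> 'b) \<otimes> 'c \<Rightarrow> _)" (is ?lin)
    and tensor_assoc_tensor: "tensor_assoc ((x \<otimes> y) \<otimes> z) = x \<otimes> y \<otimes> z" (is ?eq)
proof -
  have 1: "cbilinear (\<lambda>(x::'a) (y::'b). x \<otimes> y \<otimes> z)" for z :: 'c
    by (simp add: cbilinear_iff tensor_simps)
  note lin = clinear_tensor_lift[OF 1, unfolded clinear_iff, rule_format]
  have "cbilinear (\<lambda>t (z::'c). tensor_lift (\<lambda>(x::'a) (y::'b). x \<otimes> y \<otimes> z) t)"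
    unfolding cbilinear_iff
  proof (intro conjI allI)
    fix t :: "'a \<otimes> 'b" and z z' :: 'c and c
    show "tensor_lift (\<lambda>x y. x \<otimes> y \<otimes> (z + z')) t =
        tensor_lift (\<lambda>x y. x \<otimes> y \<otimes> z) t + tensor_lift (\<lambda>x y. x \<otimes> y \<otimes> z') t"
      by (induction t rule: tensor_induct)
        (simp_all only: clinear_zero[OF clinear_tensor_lift[OF 1]] tensor_lift_tensor[OF 1] lin,
          simp_all add: tensor_simps ac_simps)
    show "tensor_lift (\<lambda>x y. x \<otimes> y \<otimes> (c *\<^sub>C z)) t = c *\<^sub>C tensor_lift (\<lambda>x y. x \<otimes> y \<otimes> z) t"
      by (induction t rule: tensor_induct)
        (simp_all only: clinear_zero[OF clinear_tensor_lift[OF 1]] tensor_lift_tensor[OF 1] lin,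
          simp_all add: tensor_simps scaleC_add_right)
  qed (simp_all only: lin)
  from clinear_tensor_lift[OF this] tensor_lift_tensor[OF this] tensor_lift_tensor[OF 1]
  show ?lin ?eq
    by (simp_all add: tensor_assoc_def)
qed

lemma
  fixes x :: "'a::complex_vector" and y :: "'b::complex_vector" and z :: "'c::complex_vector"
  shows clinear_tensor_unassoc: "clinear (tensor_unassoc :: 'a \<otimes> 'b \<otimes> 'c \<Rightarrow> _)" (is ?lin)
    and tensor_unassoc_tensor: "tensor_unassoc (x \<otimes> y \<otimes> z) = (x \<otimes> y) \<otimes> z" (is ?eq)
proof -
  have 1: "cbilinear (\<lambda>(y::'b) (z::'c). (x \<otimes> y) \<otimes> z)" for x :: 'a
    by (simp add: cbilinear_iff tensor_simps)
  note lin = clinear_tensor_lift[OF 1, unfolded clinear_iff, rule_format]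
  have "cbilinear (\<lambda>(x::'a) t. tensor_lift (\<lambda>(y::'b) (z::'c). (x \<otimes> y) \<otimes> z) t)"
    unfolding cbilinear_iff
  proof (intro conjI allI)
    fix t :: "'b \<otimes> 'c" and x x' :: 'a and c
    show "tensor_lift (\<lambda>y z. ((x + x') \<otimes> y) \<otimes> z) t =
        tensor_lift (\<lambda>y z. (x \<otimes> y) \<otimes> z) t + tensor_lift (\<lambda>y z. (x' \<otimes> y) \<otimes> z) t"
      by (induction t rule: tensor_induct)
        (simp_all only: clinear_zero[OF clinear_tensor_lift[OF 1]] tensor_lift_tensor[OF 1] lin,
          simp_all add: tensor_simps ac_simps)
    show "tensor_lift (\<lambda>y z. ((c *\<^sub>C x) \<otimes> y) \<otimes> z) t = c *\<^sub>C tensor_lift (\<lambda>y z. (x \<otimes> y) \<otimes> z) t"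
      by (induction t rule: tensor_induct)
        (simp_all only: clinear_zero[OF clinear_tensor_lift[OF 1]] tensor_lift_tensor[OF 1] lin,
          simp_all add: tensor_simps scaleC_add_right)
  qed (simp_all only: lin)
  from clinear_tensor_lift[OF this] tensor_lift_tensor[OF this] tensor_lift_tensor[OF 1]
  show ?lin ?eq
    by (simp_all add: tensor_unassoc_def)
qed

definition on12 ::
    "('a::complex_vector \<otimes> 'b::complex_vector \<Rightarrow> 'c::complex_vector \<otimes> 'd::complex_vector)
      \<Rightarrow> 'a \<otimes> 'b \<otimes> 'e::complex_vector \<Rightarrow> 'c \<otimes> 'd \<otimes> 'e"
  where "on12 f = tensor_assoc \<circ> tensor_map f id \<circ> tensor_unassoc"

definition on23 ::
    "('a::complex_vector \<otimes> 'b::complex_vector \<Rightarrow> 'c::complex_vector \<otimes> 'd::complex_vector)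
      \<Rightarrow> 'e::complex_vector \<otimes> 'a \<otimes> 'b \<Rightarrow> 'e \<otimes> 'c \<otimes> 'd"
  where "on23 f = tensor_map id f"

text \<open>
  A zero algebra, where the unit equals \<open>0\<close>, is admitted.
\<close>

locale complex_unital_algebra =
  fixes mult :: "'a::complex_vector \<Rightarrow> 'a \<Rightarrow> 'a" and unit :: 'a
  assumes bilinear: "cbilinear mult"
    and assoc: "mult (mult x y) z = mult x (mult y z)"
    and unit_left: "mult unit x = x"
    and unit_right: "mult x unit = x"

text \<open>
  On the right-associated product \<open>'b \<otimes> 'a \<otimes> 'b \<otimes> 'a\<close> the map
  \<open>id \<otimes> \<sigma> \<otimes> id\<close> is \<open>on23\<close> of \<open>on12 \<sigma>\<close>; the maps \<open>tensor_assoc\<close> and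
  \<open>tensor_unassoc\<close> only move the brackets.
\<close>

definition twisted_mult ::
    "('a::complex_vector \<Rightarrow> 'a \<Rightarrow> 'a) \<Rightarrow> ('b::complex_vector \<Rightarrow> 'b \<Rightarrow> 'b)
      \<Rightarrow> ('a \<otimes> 'b \<Rightarrow> 'b \<otimes> 'a) \<Rightarrow> 'b \<otimes> 'a \<Rightarrow> 'b \<otimes> 'a \<Rightarrow> 'b \<otimes> 'a"
  where "twisted_mult mult_A mult_B \<sigma> s t =
    (tensor_map (tensor_lift mult_B) (tensor_lift mult_A) \<circ> tensor_unassoc
      \<circ> on23 (on12 \<sigma>) \<circ> tensor_assoc) (s \<otimes> t)"

end

theory Submission
  imports Defs
begin

text \<open>
  Write \<open>b \<cdot> t\<close> for the action of \<open>B\<close> on the left factor of \<open>B \<otimes> A\<close> and \<open>t \<cdot> a\<close> for the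
  action of \<open>A\<close> on the right factor. The two actions commute, and
  \<open>(b \<otimes> a) * (b' \<otimes> a') = b \<cdot> \<sigma>(a \<otimes> b') \<cdot> a'\<close>. Since \<open>A\<close> and \<open>B\<close> are associative, \<open>*\<close> is a
  map of \<open>B\<close>-modules in its left argument and of \<open>A\<close>-modules in its right argument.

  The hexagon for \<open>\<mu>\<^sub>A\<close> says that \<open>\<sigma>(a a' \<otimes> b)\<close> is \<open>1 \<otimes> a\<close> multiplied by \<open>\<sigma>(a' \<otimes> b)\<close>, and the
  hexagon for \<open>\<mu>\<^sub>B\<close> says that \<open>\<sigma>(a \<otimes> b b')\<close> is \<open>\<sigma>(a \<otimes> b)\<close> multiplied by \<open>b' \<otimes> 1\<close>. By
  linearity, an inner action can therefore be moved through the product: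
  \<open>(s \<cdot> a) * (b \<otimes> a') = (s * \<sigma>(a \<otimes> b)) \<cdot> a'\<close> and
  \<open>(b \<otimes> a) * (b' \<cdot> t) = b \<cdot> (\<sigma>(a \<otimes> b') * t)\<close>
  (lemmas \<open>prod_right_act_left\<close> and \<open>prod_left_act_right\<close>). With these rules both bracketings
  of \<open>(b \<otimes> a) * (b' \<otimes> a') * (b'' \<otimes> a'')\<close> become
  \<open>b \<cdot> (\<sigma>(a \<otimes> b') * \<sigma>(a' \<otimes> b'')) \<cdot> a''\<close>, and associativity follows because pure tensors span.
  The unit laws are immediate from the values of \<open>\<sigma>\<close> on \<open>1 \<otimes> b\<close> and \<open>a \<otimes> 1\<close>.
\<close>

lemma clinear_add: "clinear f \<Longrightarrow> f (x + y) = f x + f y"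
  by (simp add: clinear_iff)

lemma tensor_zero: "0 \<otimes> y = 0" "x \<otimes> 0 = 0"
  using cbilinear_tensor by (auto simp: cbilinear_def dest: clinear_zero)

lemma clinear_on12: "clinear f \<Longrightarrow> clinear (on12 f)"
  unfolding on12_def
  by (intro clinear_compose clinear_tensor_unassoc clinear_tensor_map clinear_tensor_assoc
      clinear_id)

lemma clinear_on23: "clinear f \<Longrightarrow> clinear (on23 f)"
  unfolding on23_def by (intro clinear_tensor_map clinear_id)

lemma on12_tensor: "clinear f \<Longrightarrow> on12 f (x \<otimes> y \<otimes> z) = tensor_assoc (f (x \<otimes> y) \<otimes> z)"
  by (simp add: on12_def tensor_unassoc_tensor tensor_map_tensor clinear_id)

lemma on23_tensor: "clinear f \<Longrightarrow> on23 f (x \<otimes> t) = x \<otimes> f t"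
  by (simp add: on23_def tensor_map_tensor clinear_id)

locale twisting_map =
  A: complex_unital_algebra mult_A one_A + B: complex_unital_algebra mult_B one_B
  for mult_A :: "'a::complex_vector \<Rightarrow> 'a \<Rightarrow> 'a" and one_A
    and mult_B :: "'b::complex_vector \<Rightarrow> 'b \<Rightarrow> 'b" and one_B +
  fixes \<sigma> :: "'a \<otimes> 'b \<Rightarrow> 'b \<otimes> 'a"
  assumes clinear_twist: "clinear \<sigma>"
    and hexagon_A: "\<sigma> \<circ> (tensor_map (tensor_lift mult_A) id \<circ> tensor_unassoc) =
      tensor_map id (tensor_lift mult_A) \<circ> on12 \<sigma> \<circ> on23 \<sigma>"
    and hexagon_B: "\<sigma> \<circ> tensor_map id (tensor_lift mult_B) =
      (tensor_map (tensor_lift mult_B) id \<circ> tensor_unassoc) \<circ> on23 \<sigma> \<circ> on12 \<sigma>"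
    and twist_unit_left: "\<sigma> (one_A \<otimes> b) = b \<otimes> one_A"
    and twist_unit_right: "\<sigma> (a \<otimes> one_B) = one_B \<otimes> a"
begin

abbreviation twisted_prod (infixl \<open>\<star>\<close> 65)
  where "s \<star> t \<equiv> twisted_mult mult_A mult_B \<sigma> s t"

definition left_act :: "'b \<Rightarrow> 'b \<otimes> 'a \<Rightarrow> 'b \<otimes> 'a"
  where "left_act b = tensor_map (mult_B b) id"

definition right_act :: "'a \<Rightarrow> 'b \<otimes> 'a \<Rightarrow> 'b \<otimes> 'a"
  where "right_act a = tensor_map id (\<lambda>a'. mult_A a' a)"

lemma clinear_mult:
  "clinear (mult_A a)" "clinear (\<lambda>a'. mult_A a' a)"
  "clinear (mult_B b)" "clinear (\<lambda>b'. mult_B b' b)"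
  using A.bilinear B.bilinear by (auto simp: cbilinear_def)

lemma clinear_lift_mult: "clinear (tensor_lift mult_A)" "clinear (tensor_lift mult_B)"
  by (simp_all add: clinear_tensor_lift A.bilinear B.bilinear)

lemma lift_mult_tensor:
  "tensor_lift mult_A (a \<otimes> a') = mult_A a a'" "tensor_lift mult_B (b \<otimes> b') = mult_B b b'"
  by (simp_all add: tensor_lift_tensor A.bilinear B.bilinear)

lemma clinear_left_act: "clinear (left_act b)"
  unfolding left_act_def by (intro clinear_tensor_map clinear_mult clinear_id)

lemma clinear_right_act: "clinear (right_act a)"
  unfolding right_act_def by (intro clinear_tensor_map clinear_mult clinear_id)

lemma left_act_tensor: "left_act b (b' \<otimes> a) = mult_B b b' \<otimes> a"
  by (simp add: left_act_def tensor_map_tensor clinear_mult clinear_id)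

lemma right_act_tensor: "right_act a (b \<otimes> a') = b \<otimes> mult_A a' a"
  by (simp add: right_act_def tensor_map_tensor clinear_mult clinear_id)

lemma cbilinear_prod: "cbilinear (\<star>)"
proof -
  define F where "F = tensor_map (tensor_lift mult_B) (tensor_lift mult_A) \<circ> tensor_unassoc
      \<circ> on23 (on12 \<sigma>) \<circ> (tensor_assoc :: ('b \<otimes> 'a) \<otimes> 'b \<otimes> 'a \<Rightarrow> _)"
  have "clinear F"
    unfolding F_def
    by (intro clinear_compose clinear_tensor_assoc clinear_on23 clinear_on12 clinear_twist
        clinear_tensor_unassoc clinear_tensor_map clinear_lift_mult)
  moreover have "s \<star> t = F (s \<otimes> t)" for s t
    by (simp add: twisted_mult_def F_def)
  ultimately show ?thesis
    by (simp add: cbilinear_iff clinear_iff tensor_simps)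
qed

lemma clinear_prod_left: "clinear (\<lambda>s. s \<star> t)" and clinear_prod_right: "clinear (\<lambda>t. s \<star> t)"
  using cbilinear_prod by (auto simp: cbilinear_def)

text \<open>
  An identity between maps that are linear in \<open>t\<close> only has to be checked on pure tensors: in an
  induction over \<open>t\<close>, these rules settle the cases of zero and of a sum.
\<close>

lemmas linear_zero = tensor_zero clinear_zero[OF clinear_left_act]
  clinear_zero[OF clinear_right_act] clinear_zero[OF clinear_prod_left]
  clinear_zero[OF clinear_prod_right] clinear_zero[OF clinear_tensor_assoc]
  clinear_zero[OF clinear_tensor_unassoc]
  clinear_zero[OF clinear_tensor_map[OF clinear_id(1) clinear_lift_mult(1)]]
  clinear_zero[OF clinear_tensor_map[OF clinear_lift_mult(2) clinear_id(1)]]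
  clinear_zero[OF clinear_tensor_map[OF clinear_lift_mult(2) clinear_lift_mult(1)]]
  clinear_zero[OF clinear_on12[OF clinear_twist]] clinear_zero[OF clinear_on23[OF clinear_twist]]

lemmas linear_add = tensor_simps(1,2) clinear_add[OF clinear_left_act]
  clinear_add[OF clinear_right_act] clinear_add[OF clinear_prod_left]
  clinear_add[OF clinear_prod_right] clinear_add[OF clinear_tensor_assoc]
  clinear_add[OF clinear_tensor_unassoc]
  clinear_add[OF clinear_tensor_map[OF clinear_id(1) clinear_lift_mult(1)]]
  clinear_add[OF clinear_tensor_map[OF clinear_lift_mult(2) clinear_id(1)]]
  clinear_add[OF clinear_tensor_map[OF clinear_lift_mult(2) clinear_lift_mult(1)]]
  clinear_add[OF clinear_on12[OF clinear_twist]] clinear_add[OF clinear_on23[OF clinear_twist]]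

lemmas linear_simps = linear_zero linear_add

lemma acts_commute: "left_act b (right_act a t) = right_act a (left_act b t)"
  by (induction t rule: tensor_induct)
    (simp_all add: linear_simps left_act_tensor right_act_tensor)

lemma left_act_mult: "left_act (mult_B b b') t = left_act b (left_act b' t)"
  by (induction t rule: tensor_induct)
    (simp_all add: linear_simps left_act_tensor B.assoc)

lemma right_act_mult: "right_act (mult_A a a') t = right_act a' (right_act a t)"
  by (induction t rule: tensor_induct)
    (simp_all add: linear_simps right_act_tensor A.assoc)

lemma left_act_one: "left_act one_B t = t"
  by (induction t rule: tensor_induct)
    (simp_all add: linear_simps left_act_tensor B.unit_left)

lemma right_act_one: "right_act one_A t = t"
  by (induction t rule: tensor_induct)
    (simp_all add: linear_simps right_act_tensor A.unit_right)

text \<open>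
  For a fixed value of \<open>\<sigma> (a \<otimes> b')\<close> the two multiplications outside act independently, one on
  each tensor factor. As \<open>\<sigma> (a \<otimes> b')\<close> need not be a pure tensor, the identity is checked with an
  arbitrary tensor in its place, where linearity applies.
\<close>

lemma prod_tensor: "(b \<otimes> a) \<star> (b' \<otimes> a') = left_act b (right_act a' (\<sigma> (a \<otimes> b')))"
proof -
  have "tensor_map (tensor_lift mult_B) (tensor_lift mult_A)
      (tensor_unassoc (b \<otimes> tensor_assoc (t \<otimes> a'))) = left_act b (right_act a' t)" for t
    by (induction t rule: tensor_induct)
      (simp_all add: linear_simps tensor_assoc_tensor tensor_unassoc_tensor tensor_map_tensor
        clinear_lift_mult lift_mult_tensor left_act_tensor right_act_tensor)
  then show ?thesis
    by (simp add: twisted_mult_def tensor_assoc_tensor on23_tensor on12_tensor clinear_on12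
        clinear_twist)
qed

lemma prod_left_act: "left_act b s \<star> t = left_act b (s \<star> t)"
proof -
  have "left_act b (b' \<otimes> a) \<star> t = left_act b ((b' \<otimes> a) \<star> t)" for b' a
    by (induction t rule: tensor_induct)
      (simp_all add: linear_simps left_act_tensor prod_tensor left_act_mult)
  then show ?thesis
    by (induction s rule: tensor_induct) (simp_all add: linear_simps)
qed

lemma prod_right_act: "s \<star> right_act a t = right_act a (s \<star> t)"
proof -
  have "(b' \<otimes> a') \<star> right_act a t = right_act a ((b' \<otimes> a') \<star> t)" for b' a'
    by (induction t rule: tensor_induct)
      (simp_all add: linear_simps right_act_tensor prod_tensor right_act_mult acts_commute)
  then show ?thesis
    by (induction s rule: tensor_induct) (simp_all add: linear_simps)
qed

text \<open>
  The right-hand side of the hexagon for \<open>\<mu>\<^sub>A\<close>, evaluated at \<open>a \<otimes> a' \<otimes> b\<close>, is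
  \<open>(id \<otimes> \<mu>\<^sub>A) (\<sigma>\<^sub>1\<^sub>2 (a \<otimes> t))\<close> with \<open>t = \<sigma> (a' \<otimes> b)\<close>. This expression is linear in \<open>t\<close>, and on a
  pure tensor \<open>t\<close> it is the product of \<open>1 \<otimes> a\<close> with \<open>t\<close>. Acting by \<open>b'\<close> on both sides gives
  \<open>b' \<otimes> a\<close> in place of \<open>1 \<otimes> a\<close>.
\<close>

lemma left_act_twist_mult_A: "left_act b' (\<sigma> (mult_A a a' \<otimes> b)) = (b' \<otimes> a) \<star> \<sigma> (a' \<otimes> b)"
proof -
  have right: "tensor_map id (tensor_lift mult_A) (tensor_assoc (u \<otimes> a'')) = right_act a'' u"
    for u a''
    by (induction u rule: tensor_induct)
      (simp_all add: linear_simps tensor_assoc_tensor tensor_map_tensor clinear_lift_mult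
        clinear_id lift_mult_tensor right_act_tensor)
  have "left_act b' (tensor_map id (tensor_lift mult_A) (on12 \<sigma> (a \<otimes> t))) = (b' \<otimes> a) \<star> t" for t
    by (induction t rule: tensor_induct)
      (simp_all add: linear_simps on12_tensor clinear_twist right[unfolded id_def] prod_tensor)
  with fun_cong[OF hexagon_A, of "a \<otimes> a' \<otimes> b"] show ?thesis
    by (simp add: tensor_unassoc_tensor tensor_map_tensor clinear_lift_mult clinear_id
        lift_mult_tensor on23_tensor clinear_twist)
qed

text \<open>
  The mirror image: for \<open>t = \<sigma> (a \<otimes> b)\<close> the right-hand side of the hexagon for \<open>\<mu>\<^sub>B\<close> is linear in
  \<open>t\<close>, and on a pure tensor it is the product of \<open>t\<close> with \<open>b' \<otimes> 1\<close>.
\<close>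

lemma right_act_twist_mult_B: "right_act a' (\<sigma> (a \<otimes> mult_B b b')) = \<sigma> (a \<otimes> b) \<star> (b' \<otimes> a')"
proof -
  have left: "tensor_map (tensor_lift mult_B) id (tensor_unassoc (b'' \<otimes> u)) = left_act b'' u"
    for u b''
    by (induction u rule: tensor_induct)
      (simp_all add: linear_simps tensor_unassoc_tensor tensor_map_tensor clinear_lift_mult
        clinear_id lift_mult_tensor left_act_tensor)
  have "right_act a' (tensor_map (tensor_lift mult_B) id
      (tensor_unassoc (on23 \<sigma> (tensor_assoc (t \<otimes> b'))))) = t \<star> (b' \<otimes> a')" for t
    by (induction t rule: tensor_induct)
      (simp_all add: linear_simps tensor_assoc_tensor on23_tensor clinear_twist left[unfolded id_def]
        prod_tensor acts_commute)
  with fun_cong[OF hexagon_B, of "a \<otimes> b \<otimes> b'"] show ?thesis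
    by (simp add: tensor_map_tensor clinear_lift_mult clinear_id lift_mult_tensor on12_tensor
        clinear_twist)
qed

text \<open>
  These two rules are what associativity rests on: an action on the inner side of a product can
  be exchanged for an application of \<open>\<sigma>\<close>. They extend the two preceding lemmas by linearity in
  the argument that carries the action.
\<close>

lemma prod_right_act_left: "right_act a s \<star> (b \<otimes> a') = right_act a' (s \<star> \<sigma> (a \<otimes> b))"
  by (induction s rule: tensor_induct)
    (simp_all add: linear_simps right_act_tensor prod_tensor acts_commute
      flip: left_act_twist_mult_A)

lemma prod_left_act_right: "(b \<otimes> a) \<star> left_act b' t = left_act b (\<sigma> (a \<otimes> b') \<star> t)"
  by (induction t rule: tensor_induct)
    (simp_all add: linear_simps left_act_tensor prod_tensor flip: right_act_twist_mult_B)

lemma prod_assoc: "(r \<star> s) \<star> t = r \<star> (s \<star> t)"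
proof -
  have pure: "((b \<otimes> a) \<star> (b' \<otimes> a')) \<star> (b'' \<otimes> a'') = (b \<otimes> a) \<star> ((b' \<otimes> a') \<star> (b'' \<otimes> a''))"
    for b a b' a' b'' a''
  proof -
    have "((b \<otimes> a) \<star> (b' \<otimes> a')) \<star> (b'' \<otimes> a'')
        = left_act b (right_act a'' (\<sigma> (a \<otimes> b') \<star> \<sigma> (a' \<otimes> b'')))"
      by (simp add: prod_tensor[of b a] prod_left_act prod_right_act_left)
    also have "\<dots> = (b \<otimes> a) \<star> ((b' \<otimes> a') \<star> (b'' \<otimes> a''))"
      by (simp add: prod_tensor[of b' a'] prod_right_act prod_left_act_right)
    finally show ?thesis .
  qed
  have "((b \<otimes> a) \<star> (b' \<otimes> a')) \<star> t = (b \<otimes> a) \<star> ((b' \<otimes> a') \<star> t)" for b a b' a'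
    by (induction t rule: tensor_induct) (simp_all add: linear_simps pure)
  then have "((b \<otimes> a) \<star> s) \<star> t = (b \<otimes> a) \<star> (s \<star> t)" for b a
    by (induction s rule: tensor_induct) (simp_all add: linear_simps)
  then show ?thesis
    by (induction r rule: tensor_induct) (simp_all add: linear_simps)
qed

lemma prod_unit_left: "(one_B \<otimes> one_A) \<star> t = t"
  by (induction t rule: tensor_induct)
    (simp_all add: linear_simps prod_tensor twist_unit_left left_act_one right_act_tensor A.unit_left)

lemma prod_unit_right: "t \<star> (one_B \<otimes> one_A) = t"
  by (induction t rule: tensor_induct)
    (simp_all add: linear_simps prod_tensor twist_unit_right right_act_one left_act_tensor B.unit_right)

end

theorem proposition1:
  fixes mult_A :: "'a::complex_vector \<Rightarrow> 'a \<Rightarrow> 'a" and one_A :: 'a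
    and mult_B :: "'b::complex_vector \<Rightarrow> 'b \<Rightarrow> 'b" and one_B :: 'b
    and \<sigma> :: "'a \<otimes> 'b \<Rightarrow> 'b \<otimes> 'a"
  assumes "complex_unital_algebra mult_A one_A"
    and "complex_unital_algebra mult_B one_B"
    and "clinear \<sigma>"
    and "\<sigma> \<circ> (tensor_map (tensor_lift mult_A) id \<circ> tensor_unassoc) =
      tensor_map id (tensor_lift mult_A) \<circ> on12 \<sigma> \<circ> on23 \<sigma>"
    and "\<sigma> \<circ> tensor_map id (tensor_lift mult_B) =
      (tensor_map (tensor_lift mult_B) id \<circ> tensor_unassoc) \<circ> on23 \<sigma> \<circ> on12 \<sigma>"
    and "\<And>b. \<sigma> (one_A \<otimes> b) = b \<otimes> one_A"
    and "\<And>a. \<sigma> (a \<otimes> one_B) = one_B \<otimes> a"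
  shows "complex_unital_algebra (twisted_mult mult_A mult_B \<sigma>) (one_B \<otimes> one_A)"
proof -
  interpret twisting_map mult_A one_A mult_B one_B \<sigma>
    using assms by (simp add: twisting_map_def twisting_map_axioms_def)
  show ?thesis
    by unfold_locales (rule cbilinear_prod prod_assoc prod_unit_left prod_unit_right)+
qed

end
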